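(* Let $G$ be any connected graph of order $n\ge 2$, and let $k$ be a positive integer. Then $2\le \gamma_k(G)+\dim_k(G)\le n$, and $\gamma_k(G)+\dim_k(G)=2$ if and only if $G\in\bigcup_{i=2}^{k+2}\{P_i\}$ (up to isomorphism).
   Context: All graphs are finite, simple, undirected and connected. $P_i$ denotes the path on $i$ vertices. $d(x,y)$ is the length of a shortest path between $x$ and $y$ in $G$. For a positive integer $k$, let $d_k(x,y)=\min\{d(x,y),k+1\}$. A set $D\subseteq V(G)$ is a distance-$k$ dominating set of $G$ if for each $u\in V(G)\setminus D$ there is $w\in D$ with $d(u,w)\le k$; the distance-$k$ domination number $\gamma_k(G)$ is the minimum cardinality of a distance-$k$ dominating set. A set $S\subseteq V(G)$ is a distance-$k$ resolving set of $G$ if for any distinct $x,y\in V(G)$ there is $z\in S$ with $d_k(x,z)\ne d_k(y,z)$; the distance-$k$ dimension $\dim_k(G)$ is the minimum cardinality of a distance-$k$ resolving set. *)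

theory Defs
  imports "Graph_Theory.Graph_Theory"
begin

text \<open>
  A finite simple undirected graph is a \<^locale>\<open>pair_graph\<close>: an undirected edge is represented by
  the two arcs \<open>(u, v)\<close> and \<open>(v, u)\<close>. The length of a path is the number of its arcs.

  The value of \<open>gdist G x y\<close> is meaningful only if \<open>y\<close> is reachable from \<open>x\<close>, as is always the
  case in a connected graph.
\<close>

definition gdist :: "'a pair_pre_digraph \<Rightarrow> 'a \<Rightarrow> 'a \<Rightarrow> nat" where
  "gdist G x y = (LEAST l. \<exists>p. pre_digraph.apath G x p y \<and> length p = l)"

definition trunc_dist :: "'a pair_pre_digraph \<Rightarrow> nat \<Rightarrow> 'a \<Rightarrow> 'a \<Rightarrow> nat" where
  "trunc_dist G k x y = min (gdist G x y) (k + 1)"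

definition distance_dominating_set :: "'a pair_pre_digraph \<Rightarrow> nat \<Rightarrow> 'a set \<Rightarrow> bool" where
  "distance_dominating_set G k D \<longleftrightarrow>
     D \<subseteq> pverts G \<and> (\<forall>u \<in> pverts G - D. \<exists>w \<in> D. gdist G u w \<le> k)"

definition distance_domination_number :: "'a pair_pre_digraph \<Rightarrow> nat \<Rightarrow> nat" where
  "distance_domination_number G k = (LEAST m. \<exists>D. distance_dominating_set G k D \<and> card D = m)"

definition distance_resolving_set :: "'a pair_pre_digraph \<Rightarrow> nat \<Rightarrow> 'a set \<Rightarrow> bool" where
  "distance_resolving_set G k S \<longleftrightarrow>
     S \<subseteq> pverts G \<and>
     (\<forall>x \<in> pverts G. \<forall>y \<in> pverts G. x \<noteq> y \<longrightarrow>
        (\<exists>z \<in> S. trunc_dist G k x z \<noteq> trunc_dist G k y z))"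

definition distance_dimension :: "'a pair_pre_digraph \<Rightarrow> nat \<Rightarrow> nat" where
  "distance_dimension G k = (LEAST m. \<exists>S. distance_resolving_set G k S \<and> card S = m)"

definition path_graph :: "nat \<Rightarrow> nat pair_pre_digraph" where
  "path_graph i =
     \<lparr> pverts = {..<i}, parcs = {(a, b). a < i \<and> b < i \<and> (b = Suc a \<or> a = Suc b)} \<rparr>"

lemma pair_graph_path_graph: "pair_graph (path_graph i)"
proof
  show "finite (parcs (path_graph i))"
    by (rule finite_subset[of _ "{..<i} \<times> {..<i}"]) (auto simp: path_graph_def)
  show "symmetric (path_graph i)"
    by (auto simp: symmetric_def sym_def path_graph_def)
qed (auto simp: path_graph_def)

text \<open>On reachable pairs, \<open>gdist\<close> is the library's shortest-path cost for unit weights.\<close>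

lemma (in pair_fin_digraph) gdist_eq_mu:
  assumes "x \<rightarrow>\<^sup>*\<^bsub>G\<^esub> y"
  shows "\<mu> (\<lambda>_. 1) x y = ereal (real (gdist G x y))"
proof -
  have cost: "awalk_cost (\<lambda>_. 1) p = real (length p)" for p
    by (induct p) simp_all
  obtain p where p: "apath x p y" "\<mu> (\<lambda>_. 1) x y = awalk_cost (\<lambda>_. 1) p"
    using min_cost_awalk[OF assms, of "\<lambda>_. 1"] by auto
  have "gdist G x y = length p"
    unfolding gdist_def
  proof (rule Least_equality)
    show "\<exists>q. apath x q y \<and> length q = length p"
      using p(1) by blast
  next
    fix l assume "\<exists>q. apath x q y \<and> length q = l"
    then obtain q where q: "apath x q y" "length q = l" by blast
    then have "\<mu> (\<lambda>_. 1) x y \<le> awalk_cost (\<lambda>_. 1) q"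
      by (intro min_cost_le_walk_cost) (simp add: apath_def)
    with p(2) q(2) show "length p \<le> l" by (simp add: cost)
  qed
  with p(2) show ?thesis by (simp add: cost)
qed

end

theory Submission
  imports Defs
begin

text \<open>
  Bollobas and Cockayne: a minimum dominating set \<open>D\<close> that contains as few vertices as possible
  without a neighbour in \<open>D\<close> assigns to each of its vertices \<open>x\<close> a neighbour outside \<open>D\<close> that is
  adjacent to no other vertex of \<open>D\<close>. That neighbour is at distance 1 from \<open>x\<close> and at distance at
  least 2 from the rest of \<open>D\<close>, so the complement of \<open>D\<close> is resolving for every \<open>k \<ge> 1\<close>, and
  \<open>\<gamma>\<^sub>k + dim\<^sub>k \<le> |D| + (n - |D|)\<close>. If a single vertex \<open>z\<close> is resolving, then the distance
  to \<open>z\<close> is an injection onto an initial segment of the naturals that makes \<open>G\<close> a path, and since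
  the truncated distances take only \<open>k + 2\<close> values, this path has at most \<open>k + 2\<close> vertices.
\<close>

section \<open>Distances in connected graphs\<close>

context pair_fin_digraph
begin

lemma ex_shortest_awalk:
  assumes "x \<rightarrow>\<^sup>*\<^bsub>G\<^esub> y"
  shows "\<exists>p. awalk x p y \<and> length p = gdist G x y"
proof -
  have "\<exists>l p. apath x p y \<and> length p = l"
    using assms by (simp add: reachable_apath)
  then have "\<exists>p. apath x p y \<and> length p = gdist G x y"
    unfolding gdist_def by (rule LeastI_ex)
  then show ?thesis
    by (auto simp: apath_def)
qed

text \<open>\<open>gdist\<close> minimises over paths, whereas \<open>\<mu>\<close> is an infimum
  over all walks. Passing through unit weights extends the bound to walks that repeat
  vertices.\<close>

lemma gdist_le_length:
  assumes "awalk x p y"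
  shows "gdist G x y \<le> length p"
proof -
  have "awalk_cost (\<lambda>_. 1) q = real (length q)" for q :: "('a \<times> 'a) awalk"
    by (induct q) simp_all
  moreover have "x \<rightarrow>\<^sup>*\<^bsub>G\<^esub> y"
    using assms by (rule reachable_awalkI)
  ultimately show ?thesis
    using min_cost_le_walk_cost[OF assms, of "\<lambda>_. 1"] gdist_eq_mu by auto
qed

end

locale connected_pair_graph = pair_graph G for G :: "'a pair_pre_digraph" +
  assumes connected_G: "connected G"
begin

lemma reachable_in_connected:
  assumes "x \<in> pverts G" "y \<in> pverts G"
  shows "x \<rightarrow>\<^sup>*\<^bsub>G\<^esub> y"
  using connected_G assms
  unfolding connected_def strongly_connected_def
  using reachable_mk_symmetric_eq[OF pair_sym_arcs] by simp

lemma gdist_Suc_le: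
  assumes "(x, y) \<in> parcs G" "z \<in> pverts G"
  shows "gdist G x z \<le> Suc (gdist G y z)"
proof -
  obtain p where p: "awalk y p z" "length p = gdist G y z"
    using ex_shortest_awalk reachable_in_connected in_arcsD2[OF assms(1)] assms(2) by blast
  then have "awalk x ((x, y) # p) z"
    using assms by (simp add: awalk_Cons_iff)
  then show ?thesis
    using gdist_le_length p(2) by force
qed

text \<open>The second vertex of a shortest walk works: the rest of the walk bounds its distance by
  \<open>n\<close>, and \<open>gdist_Suc_le\<close> excludes anything smaller.\<close>

lemma gdist_SucE:
  assumes "x \<in> pverts G" "z \<in> pverts G" "gdist G x z = Suc n"
  obtains y where "(x, y) \<in> parcs G" "gdist G y z = n"
proof -
  obtain p where p: "awalk x p z" "length p = Suc n"
    using ex_shortest_awalk reachable_in_connected assms by metis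
  then obtain e q where q: "p = e # q" "length q = n"
    by (cases p) auto
  with p have e: "(x, snd e) \<in> parcs G" "awalk (snd e) q z"
    by (cases e; auto simp: awalk_Cons_iff)+
  moreover have "gdist G (snd e) z = n"
    using gdist_Suc_le[OF e(1) assms(2)] gdist_le_length[OF e(2)] q(2) assms(3) by simp
  ultimately show thesis
    using that by blast
qed

lemma gdist_eq_0_iff:
  assumes "x \<in> pverts G" "y \<in> pverts G"
  shows "gdist G x y = 0 \<longleftrightarrow> x = y"
proof
  assume "gdist G x y = 0"
  then obtain p where "awalk x p y" "length p = 0"
    using ex_shortest_awalk reachable_in_connected assms by metis
  then show "x = y"
    by (simp add: awalk_Nil_iff)
next
  assume "x = y"
  then have "awalk x [] y"
    using assms by (simp add: awalk_Nil_iff)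
  then show "gdist G x y = 0"
    using gdist_le_length by force
qed

lemma gdist_eq_1_iff:
  assumes "x \<in> pverts G" "y \<in> pverts G"
  shows "gdist G x y = 1 \<longleftrightarrow> (x, y) \<in> parcs G"
proof
  assume "gdist G x y = 1"
  then obtain w where "(x, w) \<in> parcs G" "gdist G w y = 0"
    using gdist_SucE[OF assms, of 0] by auto
  then show "(x, y) \<in> parcs G"
    using gdist_eq_0_iff in_arcsD2 assms(2) by metis
next
  assume xy: "(x, y) \<in> parcs G"
  have "gdist G y y = 0"
    using gdist_eq_0_iff assms(2) by simp
  then have "gdist G x y \<le> 1"
    using gdist_Suc_le[OF xy assms(2)] by simp
  moreover have "gdist G x y \<noteq> 0"
    using gdist_eq_0_iff[OF assms] no_loops' xy by blast
  ultimately show "gdist G x y = 1"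
    by simp
qed

lemma ex_neighbour:
  assumes "2 \<le> card (pverts G)" "x \<in> pverts G"
  obtains y where "(x, y) \<in> parcs G"
proof -
  have "\<not> pverts G \<subseteq> {x}"
    using assms(1) card_mono[of "{x}" "pverts G"] by auto
  then obtain z where z: "z \<in> pverts G" "z \<noteq> x"
    by blast
  then obtain n where "gdist G x z = Suc n"
    using gdist_eq_0_iff[OF assms(2) z(1)] by (cases "gdist G x z") auto
  then show thesis
    using gdist_SucE[OF assms(2) z(1)] that by blast
qed

section \<open>Domination and resolution\<close>

lemma distance_dominating_set_1_iff:
  "distance_dominating_set G 1 D \<longleftrightarrow>
    D \<subseteq> pverts G \<and> (\<forall>u \<in> pverts G - D. \<exists>w \<in> D. (u, w) \<in> parcs G)"
proof -
  have "gdist G u w \<le> 1 \<longleftrightarrow> (u, w) \<in> parcs G"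
    if "D \<subseteq> pverts G" "u \<in> pverts G - D" "w \<in> D" for u w
  proof -
    have "u \<in> pverts G" "w \<in> pverts G" "u \<noteq> w"
      using that by auto
    then show ?thesis
      using gdist_eq_1_iff[of u w] gdist_eq_0_iff[of u w] by linarith
  qed
  then show ?thesis
    unfolding distance_dominating_set_def by blast
qed

text \<open>Exchange argument: if \<open>x\<close> lacks a private neighbour outside
  \<open>D\<close>, then either \<open>x\<close> has a neighbour in \<open>D\<close> and can be
  deleted, against minimum cardinality, or it has none and can be swapped for an outside neighbour,
  against the second minimisation.\<close>

lemma ex_dominating_set_private_neighbours:
  assumes "2 \<le> card (pverts G)"
  obtains D where "distance_dominating_set G 1 D"
    and "\<And>x. x \<in> D \<Longrightarrow>
      \<exists>z \<in> pverts G - D. (x, z) \<in> parcs G \<and> (\<forall>y \<in> D - {x}. (y, z) \<notin> parcs G)"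
proof -
  let ?dom = "distance_dominating_set G 1"
  \<comment> \<open>These are the isolated vertices of the subgraph induced by \<open>D\<close>;
    their number is the secondary quantity to minimise.\<close>
  define iso where "iso D = {v \<in> D. \<forall>w \<in> D. (v, w) \<notin> parcs G}" for D
  have "?dom (pverts G)"
    by (simp add: distance_dominating_set_def)
  from ex_has_least_nat[of ?dom, OF this, of card]
  obtain D0 where D0: "?dom D0" "\<And>D. ?dom D \<Longrightarrow> card D0 \<le> card D"
    by blast
  obtain D where D: "?dom D" "card D = card D0"
    and D_min: "\<And>D'. ?dom D' \<Longrightarrow> card D' = card D0 \<Longrightarrow> card (iso D) \<le> card (iso D')"
    using ex_has_least_nat[of "\<lambda>D. ?dom D \<and> card D = card D0" D0 "\<lambda>D. card (iso D)"] D0(1)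
    by blast
  have DV: "D \<subseteq> pverts G" and dom: "\<And>u. u \<in> pverts G - D \<Longrightarrow> \<exists>w \<in> D. (u, w) \<in> parcs G"
    using D(1) unfolding distance_dominating_set_1_iff by blast+
  have finD: "finite D"
    using DV pair_finite_verts by (rule finite_subset)
  have "\<exists>z \<in> pverts G - D. (x, z) \<in> parcs G \<and> (\<forall>y \<in> D - {x}. (y, z) \<notin> parcs G)"
    if x: "x \<in> D" for x
  proof (rule ccontr)
    assume "\<not> ?thesis"
    \<comment> \<open>Every outside neighbour of \<open>x\<close> keeps a dominator when
      \<open>x\<close> leaves \<open>D\<close>.\<close>
    then have shared: "\<exists>y \<in> D - {x}. (z, y) \<in> parcs G"
      if "z \<in> pverts G - D" "(z, x) \<in> parcs G" for z
      using that arcs_symmetric by blast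
    have x_isolated: "(x, w) \<notin> parcs G" if "w \<in> D" for w
    proof
      assume xw: "(x, w) \<in> parcs G"
      then have "w \<noteq> x"
        using no_loops' by blast
      \<comment> \<open>Deleting \<open>x\<close> is harmless: \<open>w\<close> dominates
        \<open>x\<close>, and \<open>shared\<close> covers the outside vertices that relied on
        \<open>x\<close>.\<close>
      have "?dom (D - {x})"
        unfolding distance_dominating_set_1_iff
      proof (intro conjI ballI)
        show "D - {x} \<subseteq> pverts G"
          using DV by blast
        fix u assume u: "u \<in> pverts G - (D - {x})"
        show "\<exists>w \<in> D - {x}. (u, w) \<in> parcs G"
        proof (cases "u = x")
          case True
          then show ?thesis
            using xw \<open>w \<noteq> x\<close> that by blast
        next
          case False
          then show ?thesis
            using u dom[of u] shared[of u] by blast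
        qed
      qed
      moreover have "card (D - {x}) < card D"
        using finD x by (intro psubset_card_mono) auto
      ultimately show False
        using D0(2) D(2) by fastforce
    qed
    obtain z where xz: "(x, z) \<in> parcs G"
      using ex_neighbour assms x DV by blast
    then have z: "z \<in> pverts G - D" "(z, x) \<in> parcs G"
      using x_isolated in_arcsD2 arcs_symmetric by blast+
    then obtain y where y: "y \<in> D - {x}" "(z, y) \<in> parcs G"
      using shared by blast
    \<comment> \<open>The swap keeps the cardinality and the domination: \<open>z\<close> takes care
      of \<open>x\<close>, and \<open>shared\<close> of the other neighbours of
      \<open>x\<close>.\<close>
    let ?D' = "insert z (D - {x})"
    have "?dom ?D'"
      unfolding distance_dominating_set_1_iff
    proof (intro conjI ballI)
      show "?D' \<subseteq> pverts G"
        using DV z by blast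
      fix u assume u: "u \<in> pverts G - ?D'"
      show "\<exists>w \<in> ?D'. (u, w) \<in> parcs G"
      proof (cases "u = x")
        case True
        then show ?thesis
          using xz by blast
      next
        case False
        then show ?thesis
          using u dom[of u] shared[of u] by blast
      qed
    qed
    moreover have "card ?D' = card D0"
      using card_Suc_Diff1[OF finD x] finD z(1) D(2) by simp
    ultimately have "card (iso D) \<le> card (iso ?D')"
      by (rule D_min)
    \<comment> \<open>The new vertex \<open>z\<close> has the neighbour \<open>y\<close>, so it is
      not isolated. A vertex isolated in \<open>?D'\<close> is not adjacent to \<open>x\<close>
      either, hence was isolated in \<open>D\<close>. The isolated vertex \<open>x\<close> itself is
      lost.\<close>
    moreover have "iso ?D' \<subset> iso D"
    proof
      show "iso ?D' \<subseteq> iso D"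
        using y x_isolated arcs_symmetric by (fastforce simp: iso_def)
      have "x \<in> iso D" "x \<notin> iso ?D'"
        using x x_isolated z(1) by (auto simp: iso_def)
      then show "iso ?D' \<noteq> iso D"
        by blast
    qed
    moreover have "finite (iso D)"
      using finD by (simp add: iso_def)
    ultimately show False
      using psubset_card_mono by (meson leD)
  qed
  with D(1) that show thesis
    by blast
qed

section \<open>Bounds on the domination number, the dimension and their sum\<close>

lemma trunc_dist_neq_self:
  assumes "x \<in> pverts G" "y \<in> pverts G" "x \<noteq> y"
  shows "trunc_dist G k x x \<noteq> trunc_dist G k y x"
  using assms gdist_eq_0_iff[of x x] gdist_eq_0_iff[of y x] by (simp add: trunc_dist_def)

lemma distance_domination_number_le:
  "distance_dominating_set G k D \<Longrightarrow> distance_domination_number G k \<le> card D"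
  unfolding distance_domination_number_def by (rule Least_le) blast

lemma distance_dimension_le:
  "distance_resolving_set G k S \<Longrightarrow> distance_dimension G k \<le> card S"
  unfolding distance_dimension_def by (rule Least_le) blast

lemma ex_minimum_resolving_set:
  "\<exists>S. distance_resolving_set G k S \<and> card S = distance_dimension G k"
proof -
  have "distance_resolving_set G k (pverts G)"
    unfolding distance_resolving_set_def using trunc_dist_neq_self by blast
  then have "\<exists>m S. distance_resolving_set G k S \<and> card S = m"
    by blast
  then show ?thesis
    unfolding distance_dimension_def by (rule LeastI_ex)
qed

lemma distance_domination_number_pos:
  assumes "pverts G \<noteq> {}"
  shows "0 < distance_domination_number G k"
proof -
  have "distance_dominating_set G k (pverts G)"
    by (simp add: distance_dominating_set_def)
  then have "\<exists>m D. distance_dominating_set G k D \<and> card D = m"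
    by blast
  then have "\<exists>D. distance_dominating_set G k D \<and> card D = distance_domination_number G k"
    unfolding distance_domination_number_def by (rule LeastI_ex)
  then obtain D where D: "distance_dominating_set G k D" "card D = distance_domination_number G k"
    by blast
  have "finite D" "D \<noteq> {}"
    using D(1) assms pair_finite_verts
    by (auto simp: distance_dominating_set_def intro: finite_subset)
  then show ?thesis
    using D(2) card_gt_0_iff by metis
qed

text \<open>The empty set cannot separate two adjacent vertices, which are distinct because there
  are no loops.\<close>

lemma distance_dimension_pos:
  assumes "2 \<le> card (pverts G)"
  shows "0 < distance_dimension G k"
proof -
  obtain S where S: "distance_resolving_set G k S" "card S = distance_dimension G k"
    using ex_minimum_resolving_set by blast
  obtain x where "x \<in> pverts G"
    using assms by fastforce
  moreover obtain y where "(x, y) \<in> parcs G"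
    using ex_neighbour[OF assms \<open>x \<in> pverts G\<close>] .
  ultimately have "S \<noteq> {}"
    using S(1) in_arcsD2 no_loops' unfolding distance_resolving_set_def by blast
  moreover have "finite S"
    using S(1) pair_finite_verts by (auto simp: distance_resolving_set_def intro: finite_subset)
  ultimately show ?thesis
    using S(2) card_gt_0_iff by metis
qed

lemma domination_plus_dimension_le:
  assumes "2 \<le> card (pverts G)" "1 \<le> k"
  shows "distance_domination_number G k + distance_dimension G k \<le> card (pverts G)"
proof -
  obtain D where D: "distance_dominating_set G 1 D"
    and priv: "\<And>x. x \<in> D \<Longrightarrow>
      \<exists>z \<in> pverts G - D. (x, z) \<in> parcs G \<and> (\<forall>y \<in> D - {x}. (y, z) \<notin> parcs G)"
    using ex_dominating_set_private_neighbours[OF assms(1)] by blast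
  have DV: "D \<subseteq> pverts G"
    using D by (simp add: distance_dominating_set_def)
  have "distance_dominating_set G k D"
    using D assms(2) unfolding distance_dominating_set_def by (meson order_trans)
  moreover have "distance_resolving_set G k (pverts G - D)"
    unfolding distance_resolving_set_def
  proof (intro conjI ballI impI)
    fix x y assume xy: "x \<in> pverts G" "y \<in> pverts G" "x \<noteq> y"
    show "\<exists>z \<in> pverts G - D. trunc_dist G k x z \<noteq> trunc_dist G k y z"
    proof (cases "x \<in> D \<and> y \<in> D")
      case True
      \<comment> \<open>The private neighbour of \<open>x\<close> separates \<open>x\<close> from
        \<open>y\<close>. As \<open>k + 1\<close> is at least 2, truncation does not merge distance
        1 with any other distance.\<close>
      then obtain z where z: "z \<in> pverts G - D" "(x, z) \<in> parcs G" "(y, z) \<notin> parcs G"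
        using priv[of x] xy(3) by blast
      then have "gdist G x z = 1" "gdist G y z \<noteq> 1"
        using gdist_eq_1_iff xy by auto
      then have "trunc_dist G k x z \<noteq> trunc_dist G k y z"
        using assms(2) by (auto simp: trunc_dist_def)
      with z(1) show ?thesis
        by blast
    next
      \<comment> \<open>One of the two vertices lies outside \<open>D\<close> and separates itself
        from the other.\<close>
      case False
      then show ?thesis
        using trunc_dist_neq_self[OF xy, of k] trunc_dist_neq_self[OF xy(2,1) xy(3)[symmetric], of k] xy
        by (metis DiffI)
    qed
  qed auto
  moreover have "card D + card (pverts G - D) = card (pverts G)"
    using DV pair_finite_verts
    by (metis card_Diff_subset card_mono finite_subset le_add_diff_inverse)
  ultimately show ?thesis
    using distance_domination_number_le distance_dimension_le by (metis add_mono)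
qed

end

section \<open>Paths\<close>

text \<open>Isomorphism with a path, expressed by the vertex map alone; distances can then be
  compared directly with differences of labels.\<close>

definition path_labelling :: "'a pair_pre_digraph \<Rightarrow> nat \<Rightarrow> ('a \<Rightarrow> nat) \<Rightarrow> bool" where
  "path_labelling G i f \<longleftrightarrow> bij_betw f (pverts G) {..<i} \<and>
    (\<forall>u \<in> pverts G. \<forall>v \<in> pverts G. (u, v) \<in> parcs G \<longleftrightarrow> f u = Suc (f v) \<or> f v = Suc (f u))"

text \<open>An isomorphism of digraphs carries a separate arc map, but its compatibility with tails
  and heads forces that map to be the vertex map applied to both ends.\<close>

lemma (in pair_wf_digraph) digraph_iso_path_graph_iff:
  "digraph_iso G (path_graph i) \<longleftrightarrow> (\<exists>f. path_labelling G i f)"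
proof
  assume "digraph_iso G (path_graph i)"
  then obtain h where h: "digraph_isomorphism h" "with_proj (path_graph i) = app_iso h G"
    unfolding digraph_iso_def by blast
  let ?f = "iso_verts h"
  have verts: "{..<i} = ?f ` pverts G"
    using arg_cong[OF h(2), of verts] by (simp add: path_graph_def)
  have arcs: "parcs (path_graph i) = iso_arcs h ` parcs G"
    using arg_cong[OF h(2), of arcs] by simp
  \<comment> \<open>The end maps of the image graph are those stored in \<open>h\<close>; for
    \<open>path_graph i\<close> they are the projections.\<close>
  have ends: "fst = iso_tail h" "snd = iso_head h"
    using arg_cong[OF h(2), of tail] arg_cong[OF h(2), of head] by simp_all
  have inj: "inj_on ?f (pverts G)"
    using h(1) by (simp add: digraph_isomorphism_def)
  have arc: "iso_arcs h (u, v) = (?f u, ?f v)" if "(u, v) \<in> parcs G" for u v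
  proof -
    have "fst (iso_arcs h (u, v)) = ?f u" "snd (iso_arcs h (u, v)) = ?f v"
      using h(1) that ends unfolding digraph_isomorphism_def by force+
    then show ?thesis
      by (simp add: prod_eq_iff)
  qed
  have "(u, v) \<in> parcs G \<longleftrightarrow> (?f u, ?f v) \<in> parcs (path_graph i)"
    if uv: "u \<in> pverts G" "v \<in> pverts G" for u v
  proof
    assume "(u, v) \<in> parcs G"
    then show "(?f u, ?f v) \<in> parcs (path_graph i)"
      unfolding arcs using arc by (metis imageI)
  next
    assume "(?f u, ?f v) \<in> parcs (path_graph i)"
    then obtain u' v' where *: "(u', v') \<in> parcs G" "(?f u, ?f v) = (?f u', ?f v')"
      unfolding arcs using arc by fastforce
    then have "u' = u" "v' = v"
      using inj uv in_arcsD1 in_arcsD2 by (auto dest: inj_onD)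
    with * show "(u, v) \<in> parcs G"
      by simp
  qed
  moreover have "?f u < i" if "u \<in> pverts G" for u
    using verts that by blast
  ultimately have "path_labelling G i ?f"
    using verts inj unfolding path_labelling_def bij_betw_def by (auto simp: path_graph_def)
  then show "\<exists>f. path_labelling G i f"
    by blast
next
  assume "\<exists>f. path_labelling G i f"
  then obtain f where bij: "bij_betw f (pverts G) {..<i}"
    and arc_iff: "\<And>u v. u \<in> pverts G \<Longrightarrow> v \<in> pverts G \<Longrightarrow>
      (u, v) \<in> parcs G \<longleftrightarrow> f u = Suc (f v) \<or> f v = Suc (f u)"
    unfolding path_labelling_def by blast
  let ?h = "\<lparr>iso_verts = f, iso_arcs = map_prod f f, iso_head = snd, iso_tail = fst\<rparr>"
  have inj: "inj_on f (pverts G)" and img: "f ` pverts G = {..<i}"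
    using bij by (auto simp: bij_betw_def)
  have "inj_on (map_prod f f) (parcs G)"
    by (rule inj_on_subset[OF map_prod_inj_on[OF inj inj]]) (auto dest: in_arcsD1 in_arcsD2)
  then have "digraph_isomorphism ?h"
    using inj wf_digraph_axioms by (auto simp: digraph_isomorphism_def)
  moreover have "parcs (path_graph i) = map_prod f f ` parcs G"
  proof (intro equalityI subsetI)
    fix e assume "e \<in> parcs (path_graph i)"
    then obtain a b where e: "e = (a, b)" "a < i" "b < i" "b = Suc a \<or> a = Suc b"
      by (auto simp: path_graph_def)
    then obtain u v where uv: "u \<in> pverts G" "v \<in> pverts G" "a = f u" "b = f v"
      using img by (metis imageE lessThan_iff)
    then have "(u, v) \<in> parcs G"
      using arc_iff e(4) by auto
    then show "e \<in> map_prod f f ` parcs G"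
      using e(1) uv by force
  next
    fix e assume "e \<in> map_prod f f ` parcs G"
    then obtain u v where uv: "(u, v) \<in> parcs G" "e = (f u, f v)"
      by auto
    then have "u \<in> pverts G" "v \<in> pverts G"
      using in_arcsD1 in_arcsD2 by auto
    moreover from this have "f u < i" "f v < i"
      using img by auto
    ultimately show "e \<in> parcs (path_graph i)"
      using uv arc_iff by (auto simp: path_graph_def)
  qed
  then have "with_proj (path_graph i) = app_iso ?h G"
    using img by (simp add: app_iso_def with_proj_def path_graph_def)
  ultimately show "digraph_iso G (path_graph i)"
    unfolding digraph_iso_def by blast
qed

text \<open>Take the least missing number \<open>l\<close>: everything below it is present, and by
  closure nothing above it can be.\<close>

lemma downward_closed_eq_lessThan:
  fixes A :: "nat set"
  assumes "finite A" "\<And>n. Suc n \<in> A \<Longrightarrow> n \<in> A"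
  shows "A = {..<card A}"
proof -
  have *: "m \<in> A" if "n \<in> A" "m \<le> n" for m n
    using that(2,1) by (induction rule: inc_induct) (auto intro: assms(2))
  obtain m where "m \<notin> A"
    using assms(1) ex_new_if_finite infinite_UNIV_nat by blast
  define l where "l = (LEAST m. m \<notin> A)"
  have "l \<notin> A"
    unfolding l_def using \<open>m \<notin> A\<close> by (rule LeastI)
  then have "A = {..<l}"
    using * not_less_Least[of _ "\<lambda>m. m \<notin> A"] unfolding l_def[symmetric]
    by (metis lessThan_iff linorder_not_le subsetI subset_antisym)
  then show ?thesis
    by simp
qed

section \<open>Path labellings versus distances\<close>

context connected_pair_graph
begin

text \<open>Descending towards \<open>z\<close> leaves no gap among the distances. Along an arc the
  distance changes by at most 1, and by injectivity it does change.\<close>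

lemma path_labelling_gdist:
  assumes z: "z \<in> pverts G" and inj: "inj_on (\<lambda>v. gdist G v z) (pverts G)"
  shows "path_labelling G (card (pverts G)) (\<lambda>v. gdist G v z)"
proof -
  let ?f = "\<lambda>v. gdist G v z"
  have "?f ` pverts G = {..<card (?f ` pverts G)}"
  proof (rule downward_closed_eq_lessThan)
    fix n assume "Suc n \<in> ?f ` pverts G"
    then obtain u where u: "u \<in> pverts G" "gdist G u z = Suc n"
      by auto
    then obtain y where "(u, y) \<in> parcs G" "gdist G y z = n"
      using gdist_SucE z by blast
    then show "n \<in> ?f ` pverts G"
      using in_arcsD2 by blast
  qed (simp add: pair_finite_verts)
  then have "bij_betw ?f (pverts G) {..<card (pverts G)}"
    using inj by (simp add: bij_betw_def card_image)
  \<comment> \<open>Some neighbour of \<open>u\<close> is one step closer to \<open>z\<close>; by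
    injectivity it can only be \<open>v\<close>.\<close>
  moreover have down: "(u, v) \<in> parcs G"
    if uv: "u \<in> pverts G" "v \<in> pverts G" "?f u = Suc (?f v)" for u v
  proof -
    obtain y where "(u, y) \<in> parcs G" "?f y = ?f v"
      using gdist_SucE[OF uv(1) z uv(3)] by blast
    then show ?thesis
      using inj uv(2) in_arcsD2 by (metis inj_onD)
  qed
  moreover have "?f u = Suc (?f v) \<or> ?f v = Suc (?f u)" if uv: "(u, v) \<in> parcs G" for u v
  proof -
    have "?f u \<noteq> ?f v"
      using inj uv no_loops' in_arcsD1 in_arcsD2 by (metis inj_onD)
    moreover have "?f u \<le> Suc (?f v)" "?f v \<le> Suc (?f u)"
      using gdist_Suc_le z uv arcs_symmetric by blast+
    ultimately show ?thesis
      by linarith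
  qed
  ultimately show ?thesis
    unfolding path_labelling_def using arcs_symmetric by blast
qed

text \<open>Labels grow by at most 1 along each arc of a shortest walk.\<close>

lemma path_labelling_le_gdist:
  assumes "path_labelling G i f" "x \<in> pverts G" "z \<in> pverts G"
  shows "f x \<le> f z + gdist G x z"
  using assms(2)
proof (induction "gdist G x z" arbitrary: x)
  case 0
  then show ?case
    using gdist_eq_0_iff assms(3) by auto
next
  case (Suc n)
  then obtain y where y: "(x, y) \<in> parcs G" "gdist G y z = n"
    using gdist_SucE assms(3) by metis
  then have "y \<in> pverts G"
    using in_arcsD2 by blast
  moreover from this have "f x \<le> Suc (f y)"
    using y(1) Suc.prems assms(1) by (auto simp: path_labelling_def)
  ultimately show ?case
    using Suc.hyps y(2) by fastforce
qed

text \<open>With truncated subtraction, the right-hand side is the absolute difference of the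
  labels. Moving through consecutive labels from \<open>x\<close> to \<open>z\<close> takes that
  many steps.\<close>

lemma gdist_le_path_labelling:
  assumes "path_labelling G i f" "x \<in> pverts G" "z \<in> pverts G"
  shows "gdist G x z \<le> (f x - f z) + (f z - f x)"
  using assms(2)
proof (induction "(f x - f z) + (f z - f x)" arbitrary: x)
  case 0
  then have "x = z"
    using assms by (auto simp: path_labelling_def bij_betw_def dest: inj_onD)
  then show ?case
    using gdist_eq_0_iff assms(3) by simp
next
  case (Suc n)
  have img: "f ` pverts G = {..<i}"
    using assms(1) by (auto simp: path_labelling_def bij_betw_def)
  then have "f x < i" "f z < i"
    using Suc.prems assms(3) by auto
  \<comment> \<open>This is the label one step closer to \<open>f z\<close>. It stays below
    \<open>i\<close> because it lies between \<open>f x\<close> and \<open>f z\<close>.\<close>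
  define m where "m = (if f z < f x then f x - 1 else Suc (f x))"
  have "m \<in> f ` pverts G"
    using \<open>f x < i\<close> \<open>f z < i\<close> Suc.hyps(2) unfolding img m_def by auto
  then obtain y where y: "y \<in> pverts G" "f y = m"
    by auto
  then have "(x, y) \<in> parcs G"
    using assms(1) Suc.prems unfolding path_labelling_def m_def by (auto split: if_splits)
  then have "gdist G x z \<le> Suc (gdist G y z)"
    using gdist_Suc_le assms(3) by blast
  moreover have step: "n = (f y - f z) + (f z - f y)"
    using Suc.hyps(2) y(2) unfolding m_def by (auto split: if_splits)
  moreover have "gdist G y z \<le> (f y - f z) + (f z - f y)"
    using Suc.hyps(1) step y(1) by blast
  ultimately show ?case
    using Suc.hyps(2) by linarith
qed

lemma iso_path_graph_if_dimension_eq_1: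
  assumes "distance_dimension G k = 1"
  shows "card (pverts G) \<le> k + 2" "digraph_iso G (path_graph (card (pverts G)))"
proof -
  obtain S where S: "distance_resolving_set G k S" "card S = 1"
    using ex_minimum_resolving_set assms by metis
  then obtain z where "S = {z}"
    by (auto simp: card_1_singleton_iff)
  with S have z: "z \<in> pverts G" and inj: "inj_on (\<lambda>v. trunc_dist G k v z) (pverts G)"
    by (auto simp: distance_resolving_set_def inj_on_def)
  \<comment> \<open>Pigeonhole: truncated distances lie between 0 and \<open>k + 1\<close>.\<close>
  have "card (pverts G) \<le> card {..k + 1}"
    using inj by (rule card_inj_on_le) (auto simp: trunc_dist_def)
  then show "card (pverts G) \<le> k + 2"
    by simp
  have "inj_on (\<lambda>v. gdist G v z) (pverts G)"
    using inj by (auto simp: inj_on_def trunc_dist_def)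
  then show "digraph_iso G (path_graph (card (pverts G)))"
    using path_labelling_gdist z digraph_iso_path_graph_iff by blast
qed

text \<open>The endpoint labelled 0 resolves, but for \<open>i = k + 2\<close> it misses the other
  end, at distance \<open>k + 1\<close>. Its neighbour labelled 1 dominates instead: larger labels
  are within \<open>i - 2\<close>, and label 0 is within 1, which is where \<open>k\<close> being
  positive enters.\<close>

lemma domination_and_dimension_le_1_if_path_labelling:
  assumes f: "path_labelling G i f" and i: "2 \<le> i" "i \<le> k + 2" and k: "1 \<le> k"
  shows "distance_domination_number G k \<le> 1" "distance_dimension G k \<le> 1"
proof -
  have inj: "inj_on f (pverts G)" and img: "f ` pverts G = {..<i}"
    using f by (auto simp: path_labelling_def bij_betw_def)
  have less: "f x < i" if "x \<in> pverts G" for x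
    using img that by blast
  have "0 \<in> f ` pverts G" "1 \<in> f ` pverts G"
    using i(1) unfolding img by auto
  then obtain z w where z: "z \<in> pverts G" "f z = 0" and w: "w \<in> pverts G" "f w = 1"
    by (metis imageE)
  have "gdist G u w \<le> k" if u: "u \<in> pverts G" for u
    using gdist_le_path_labelling[OF f u w(1)] w(2) less[OF u] i k by linarith
  then have "distance_dominating_set G k {w}"
    using w(1) by (simp add: distance_dominating_set_def)
  then show "distance_domination_number G k \<le> 1"
    using distance_domination_number_le by force
  have "trunc_dist G k x z = f x" if x: "x \<in> pverts G" for x
  proof -
    have "gdist G x z = f x"
      using path_labelling_le_gdist[OF f x z(1)] gdist_le_path_labelling[OF f x z(1)] z(2)
      by simp
    then show ?thesis
      \<comment> \<open>All labels are at most \<open>k + 1\<close>, so truncation changes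
        nothing.\<close>
      using less[OF x] i(2) by (simp add: trunc_dist_def)
  qed
  then have "distance_resolving_set G k {z}"
    using z(1) inj by (auto simp: distance_resolving_set_def dest: inj_onD)
  then show "distance_dimension G k \<le> 1"
    using distance_dimension_le by force
qed

end

theorem proposition2p11:
  fixes G :: "'a pair_pre_digraph" and k :: nat
  assumes "pair_graph G" and "connected G" and "card (pverts G) \<ge> 2" and "k \<ge> 1"
  shows "2 \<le> distance_domination_number G k + distance_dimension G k
       \<and> distance_domination_number G k + distance_dimension G k \<le> card (pverts G)
       \<and> (distance_domination_number G k + distance_dimension G k = 2
            \<longleftrightarrow> (\<exists>i \<in> {2..k + 2}. digraph_iso G (path_graph i)))"
proof -
  interpret connected_pair_graph G
    using assms(1,2) by (intro connected_pair_graph.intro connected_pair_graph_axioms.intro)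
  have "pverts G \<noteq> {}"
    using assms(3) by auto
  then have pos: "0 < distance_domination_number G k" "0 < distance_dimension G k"
    using distance_domination_number_pos distance_dimension_pos[OF assms(3)] by auto
  have "\<exists>i \<in> {2..k + 2}. digraph_iso G (path_graph i)"
    if "distance_domination_number G k + distance_dimension G k = 2"
  proof -
    \<comment> \<open>Two positive summands with sum 2 are both 1.\<close>
    have "distance_dimension G k = 1"
      using that pos by linarith
    then show ?thesis
      using iso_path_graph_if_dimension_eq_1 assms(3) by (meson atLeastAtMost_iff)
  qed
  moreover have "distance_domination_number G k + distance_dimension G k = 2"
    if iso: "\<exists>i \<in> {2..k + 2}. digraph_iso G (path_graph i)"
  proof -
    obtain i f where "2 \<le> i" "i \<le> k + 2" "path_labelling G i f"
      using iso digraph_iso_path_graph_iff by (meson atLeastAtMost_iff)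
    then show ?thesis
      using domination_and_dimension_le_1_if_path_labelling[of i f k] assms(4) pos by linarith
  qed
  ultimately show ?thesis
    using pos domination_plus_dimension_le[OF assms(3,4)] by auto
qed

end
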